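(* Let $\alpha>0$ and let $C(s)$, $s\in(0,\infty)$, satisfy $$C''(s)=\frac{(C'(s))^2}{C(s)}-\frac{C'(s)}{s}+\frac{(C(s))^2}{s}+\frac{\alpha}{s^2}-\frac{1}{s^2\,C(s)}.$$ Under the change of variables $Y(x)=\frac{x}{2}\,C\left(\frac{x^2}{8}\right)$, $x\in(0,\infty)$, this equation becomes $$Y''=\frac{(Y')^2}{Y}-\frac{Y'}{x}+\frac{Y^2}{x}-\frac1Y+\frac{2\alpha}{x},$$ which is the Painlevé equation ${\rm P_{III}}(1,2\alpha,0,-1)$.
   Context: ${\rm P_{III}}(a,b,c,d)$ denotes the third Painlevé equation $Y''=\frac{(Y')^2}{Y}-\frac{Y'}{x}+\frac{aY^2+b}{x}+cY^3+\frac{d}{Y}$, where primes on $Y$ denote $d/dx$. *)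

theory Defs
  imports "HOL-Analysis.Analysis"
begin

text \<open>
  \<open>solves_on I F f\<close>: on the open set \<open>I\<close>, \<open>f\<close> is a twice differentiable solution of
  \<open>f'' = F(t, f, f')\<close>. The equations considered here have the unknown in a denominator, so a
  solution is required not to vanish on \<open>I\<close>.
\<close>
definition solves_on ::
  "real set \<Rightarrow> (real \<Rightarrow> real \<Rightarrow> real \<Rightarrow> real) \<Rightarrow> (real \<Rightarrow> real) \<Rightarrow> bool" where
  "solves_on I F f \<longleftrightarrow>
     (\<forall>t\<in>I. f t \<noteq> 0 \<and> f differentiable (at t) \<and> deriv f differentiable (at t) \<and>
            deriv (deriv f) t = F t (f t) (deriv f t))"

text \<open>Right-hand side of the third Painleve equation; \<open>p\<close> stands for \<open>Y'\<close>.\<close>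
definition painleve_III ::
  "real \<Rightarrow> real \<Rightarrow> real \<Rightarrow> real \<Rightarrow> real \<Rightarrow> real \<Rightarrow> real \<Rightarrow> real" where
  "painleve_III a b c d x y p = p\<^sup>2 / y - p / x + (a * y\<^sup>2 + b) / x + c * y ^ 3 + d / y"

end

theory Submission
  imports Defs
begin

text \<open>
  With \<open>s = x\<^sup>2 / 8\<close> one has \<open>ds/dx = x / 4\<close>, so the chain rule turns \<open>Y x = x / 2 * C s\<close> into
  \<open>Y' = C / 2 + s C'\<close> and \<open>Y'' = x / 4 * (3 / 2 C' + s C'')\<close>. Substituting these expressions, the
  defect \<open>Y'' - F(x, Y, Y')\<close> of the Painleve equation equals \<open>x s / 4\<close> times the defect of the
  equation for \<open>C\<close> (lemma \<open>defect_identity\<close>). Since \<open>x s / 4 \<noteq> 0\<close>, one defect vanishes exactly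
  when the other does.

  The equivalence also needs regularity to pass in both directions. The map \<open>x \<mapsto> x\<^sup>2 / 8\<close> is a
  diffeomorphism of the positive half-line with inverse \<open>s \<mapsto> sqrt (8 s)\<close>, so \<open>C\<close> is twice
  differentiable if and only if \<open>Y\<close> is; the lemmas \<open>derivs_forward\<close> and \<open>derivs_backward\<close>
  provide the derivatives.
\<close>

text \<open>
  Naming the two derivatives makes it possible to transport a solution by exhibiting the
  derivatives of its transform. Openness of \<open>I\<close> is what lets \<open>deriv f\<close> be replaced by a function
  that agrees with it only on \<open>I\<close>.
\<close>
lemma solves_on_iff_derivs:
  assumes "open I"
  shows "solves_on I F f \<longleftrightarrow>
    (\<exists>g h. \<forall>t\<in>I. f t \<noteq> 0 \<and> (f has_real_derivative g t) (at t) \<and>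
                 (g has_real_derivative h t) (at t) \<and> h t = F t (f t) (g t))"
    (is "_ \<longleftrightarrow> ?R")
proof
  assume "solves_on I F f"
  then show ?R
    unfolding solves_on_def DERIV_deriv_iff_real_differentiable[symmetric] by blast
next
  assume ?R
  then obtain g h where nz: "\<And>t. t \<in> I \<Longrightarrow> f t \<noteq> 0"
    and f': "\<And>t. t \<in> I \<Longrightarrow> (f has_real_derivative g t) (at t)"
    and g': "\<And>t. t \<in> I \<Longrightarrow> (g has_real_derivative h t) (at t)"
    and eq: "\<And>t. t \<in> I \<Longrightarrow> h t = F t (f t) (g t)"
    by blast
  have df: "deriv f t = g t" if "t \<in> I" for t
    using f'[OF that] by (rule DERIV_imp_deriv)
  have d2f: "(deriv f has_real_derivative h t) (at t)" if "t \<in> I" for t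
    using has_field_derivative_transform_within_open[OF g'[OF that] assms that] df by simp
  have "deriv (deriv f) t = F t (f t) (deriv f t)" if "t \<in> I" for t
    using DERIV_imp_deriv[OF d2f[OF that]] df[OF that] eq[OF that] by simp
  then show "solves_on I F f"
    unfolding solves_on_def real_differentiable_def using nz f' d2f by blast
qed

lemma derivs_forward:
  fixes C Y g h :: "real \<Rightarrow> real"
  assumes Y: "\<And>x. x > 0 \<Longrightarrow> Y x = x / 2 * C (x\<^sup>2 / 8)"
    and C': "\<And>s. s > 0 \<Longrightarrow> (C has_real_derivative g s) (at s)"
    and g': "\<And>s. s > 0 \<Longrightarrow> (g has_real_derivative h s) (at s)"
    and "x > 0"
  defines "G \<equiv> \<lambda>x. C (x\<^sup>2 / 8) / 2 + x\<^sup>2 / 8 * g (x\<^sup>2 / 8)"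
  shows "(Y has_real_derivative G x) (at x)"
    and "(G has_real_derivative x / 4 * (3 / 2 * g (x\<^sup>2 / 8) + x\<^sup>2 / 8 * h (x\<^sup>2 / 8))) (at x)"
proof -
  have s: "((\<lambda>x. x\<^sup>2 / 8) has_real_derivative x / 4) (at x)"
    by (auto intro!: derivative_eq_intros)
  have pos: "x\<^sup>2 / 8 > 0"
    using \<open>x > 0\<close> by simp
  note Cs = DERIV_chain2[OF C'[OF pos] s] and gs = DERIV_chain2[OF g'[OF pos] s]
  have "((\<lambda>x. x / 2 * C (x\<^sup>2 / 8)) has_real_derivative G x) (at x)"
    using DERIV_mult[OF DERIV_cdivide[OF DERIV_ident, of 2] Cs]
    by (simp add: G_def power2_eq_square mult_ac add.commute)
  then show "(Y has_real_derivative G x) (at x)"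
    by (rule has_field_derivative_transform_within_open[where S = "{0<..}"])
      (use \<open>x > 0\<close> Y in auto)
  show "(G has_real_derivative x / 4 * (3 / 2 * g (x\<^sup>2 / 8) + x\<^sup>2 / 8 * h (x\<^sup>2 / 8))) (at x)"
    using DERIV_add[OF DERIV_cdivide[OF Cs, of 2] DERIV_mult[OF s gs]]
    by (simp add: G_def algebra_simps)
qed

text \<open>
  Here \<open>C s = 2 Y x / x\<close> with \<open>x = sqrt (8 s)\<close> and \<open>dx/ds = 4 / x\<close>. The formulas for the
  derivatives of \<open>C\<close> are those of \<open>derivs_forward\<close> solved for \<open>C'\<close> and \<open>C''\<close>.
\<close>
lemma derivs_backward:
  fixes C Y G H :: "real \<Rightarrow> real"
  assumes Y: "\<And>x. x > 0 \<Longrightarrow> Y x = x / 2 * C (x\<^sup>2 / 8)"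
    and Y': "\<And>x. x > 0 \<Longrightarrow> (Y has_real_derivative G x) (at x)"
    and G': "\<And>x. x > 0 \<Longrightarrow> (G has_real_derivative H x) (at x)"
    and "s > 0"
  defines "g \<equiv> \<lambda>s. (G (sqrt (8 * s)) - C s / 2) / s"
  shows "(C has_real_derivative g s) (at s)"
    and "(g has_real_derivative (4 / sqrt (8 * s) * H (sqrt (8 * s)) - 3 / 2 * g s) / s) (at s)"
proof -
  define r where "r = sqrt (8 * s)"
  have r: "r > 0" "s = r\<^sup>2 / 8"
    using \<open>s > 0\<close> by (auto simp: r_def)
  have sqrt': "((\<lambda>s. sqrt (8 * s)) has_real_derivative 4 / r) (at s)"
    unfolding r_def using \<open>s > 0\<close> by (auto intro!: derivative_eq_intros simp: field_simps)
  have C_eq: "C t = 2 * Y (sqrt (8 * t)) / sqrt (8 * t)" if "t > 0" for t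
    using Y[of "sqrt (8 * t)"] that by (simp add: field_simps)
  have Ys: "((\<lambda>s. Y (sqrt (8 * s))) has_real_derivative G r * (4 / r)) (at s)"
    by (rule DERIV_chain2[OF _ sqrt']) (use Y'[OF r(1)] in \<open>simp add: r_def\<close>)
  have Gs: "((\<lambda>s. G (sqrt (8 * s))) has_real_derivative H r * (4 / r)) (at s)"
    by (rule DERIV_chain2[OF _ sqrt']) (use G'[OF r(1)] in \<open>simp add: r_def\<close>)
  have g_eq: "g s = (G r - Y r / r) / (r\<^sup>2 / 8)"
    using Y[OF r(1)] r(1) unfolding r(2)[symmetric] by (simp add: g_def flip: r_def)
  have "((\<lambda>s. 2 * Y (sqrt (8 * s)) / sqrt (8 * s)) has_real_derivative
      (2 * (G r * (4 / r)) * r - 2 * Y r * (4 / r)) / (r * r)) (at s)"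
    using DERIV_divide[OF DERIV_cmult[OF Ys, of 2] sqrt'] r(1) by (simp flip: r_def)
  also have "(2 * (G r * (4 / r)) * r - 2 * Y r * (4 / r)) / (r * r) = g s"
    unfolding g_eq using r(1) by (simp add: field_simps power2_eq_square)
  finally show C': "(C has_real_derivative g s) (at s)"
    by (rule has_field_derivative_transform_within_open[where S = "{0<..}"])
      (use \<open>s > 0\<close> C_eq in auto)
  have num: "((\<lambda>s. G (sqrt (8 * s)) - C s / 2) has_real_derivative H r * (4 / r) - g s / 2) (at s)"
    by (intro DERIV_diff DERIV_cdivide Gs C')
  have num_eq: "G r - C s / 2 = g s * s"
    using \<open>s > 0\<close> by (simp add: g_def r_def)
  have "(g has_real_derivative ((H r * (4 / r) - g s / 2) * s - (G r - C s / 2) * 1) / (s * s)) (at s)"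
    using DERIV_divide[OF num DERIV_ident] \<open>s > 0\<close> unfolding g_def r_def by simp
  also have "((H r * (4 / r) - g s / 2) * s - (G r - C s / 2) * 1) / (s * s)
      = (4 / r * H r - 3 / 2 * g s) / s"
    unfolding num_eq using \<open>s > 0\<close> r(1) by (simp add: field_simps)
  finally show "(g has_real_derivative
      (4 / sqrt (8 * s) * H (sqrt (8 * s)) - 3 / 2 * g s) / s) (at s)"
    by (simp add: r_def)
qed

text \<open>
  The algebraic core: \<open>c\<close>, \<open>p\<close>, \<open>q\<close> stand for \<open>C\<close>, \<open>C'\<close>, \<open>C''\<close> at \<open>s\<close>. The relation is one between
  the defects of the two equations, so it yields both directions of the equivalence.
\<close>
lemma defect_identity:
  fixes x s c p q \<alpha> :: real
  assumes "x > 0" "c \<noteq> 0" and s: "s = x\<^sup>2 / 8"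
  defines "y \<equiv> x / 2 * c" and "P \<equiv> c / 2 + s * p"
  shows "x / 4 * (3 / 2 * p + s * q) - (P\<^sup>2 / y - P / x + y\<^sup>2 / x - 1 / y + 2 * \<alpha> / x)
    = x * s / 4 * (q - (p\<^sup>2 / c - p / s + c\<^sup>2 / s + \<alpha> / s\<^sup>2 - 1 / (s\<^sup>2 * c)))"
proof -
  have s0: "s \<noteq> 0"
    unfolding s using assms(1) by simp
  have "P\<^sup>2 / y - P / x = x / 4 * (p / 2 + s * p\<^sup>2 / c)"
    unfolding y_def P_def s using assms(1,2) by (simp add: field_simps power2_eq_square)
  moreover have "y\<^sup>2 / x = x / 4 * c\<^sup>2" "1 / y = x / 4 * (1 / (s * c))" "2 * \<alpha> / x = x / 4 * (\<alpha> / s)"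
    unfolding y_def s using assms(1,2) by (simp_all add: field_simps power2_eq_square)
  moreover have "s * (q - (p\<^sup>2 / c - p / s + c\<^sup>2 / s + \<alpha> / s\<^sup>2 - 1 / (s\<^sup>2 * c)))
      = s * q - s * p\<^sup>2 / c + p - c\<^sup>2 - \<alpha> / s + 1 / (s * c)"
    using s0 \<open>c \<noteq> 0\<close> by (simp add: field_simps power2_eq_square)
  then have "x * s / 4 * (q - (p\<^sup>2 / c - p / s + c\<^sup>2 / s + \<alpha> / s\<^sup>2 - 1 / (s\<^sup>2 * c)))
      = x / 4 * (s * q - s * p\<^sup>2 / c + p - c\<^sup>2 - \<alpha> / s + 1 / (s * c))"
    by (metis mult.assoc times_divide_eq_left)
  ultimately show ?thesis
    by (simp only:) (simp add: algebra_simps)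
qed

lemma equation_iff:
  fixes x s c p q \<alpha> :: real
  assumes "x > 0" "c \<noteq> 0" "s = x\<^sup>2 / 8" "y = x / 2 * c" "P = c / 2 + s * p"
    and "Q = x / 4 * (3 / 2 * p + s * q)"
  shows "Q = P\<^sup>2 / y - P / x + y\<^sup>2 / x - 1 / y + 2 * \<alpha> / x \<longleftrightarrow>
    q = p\<^sup>2 / c - p / s + c\<^sup>2 / s + \<alpha> / s\<^sup>2 - 1 / (s\<^sup>2 * c)"
proof -
  have "x * s / 4 \<noteq> 0"
    unfolding assms(3) using assms(1) by simp
  then show ?thesis
    using defect_identity[OF assms(1-3), of p q \<alpha>] assms(4-6)
    by (metis eq_iff_diff_eq_0 mult_eq_0_iff)
qed

lemma solves_on_change_of_variables:
  fixes \<alpha> :: real and C Y :: "real \<Rightarrow> real"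
  assumes Y: "\<And>x. x > 0 \<Longrightarrow> Y x = x / 2 * C (x\<^sup>2 / 8)"
  shows "solves_on {0<..}
        (\<lambda>s c p. p\<^sup>2 / c - p / s + c\<^sup>2 / s + \<alpha> / s\<^sup>2 - 1 / (s\<^sup>2 * c)) C
      \<longleftrightarrow> solves_on {0<..}
        (\<lambda>x y p. p\<^sup>2 / y - p / x + y\<^sup>2 / x - 1 / y + 2 * \<alpha> / x) Y"
    (is "solves_on _ ?FC C \<longleftrightarrow> solves_on _ ?FY Y")
proof
  assume "solves_on {0<..} ?FC C"
  then obtain g h where nz: "\<And>s. s > 0 \<Longrightarrow> C s \<noteq> 0"
    and C': "\<And>s. s > 0 \<Longrightarrow> (C has_real_derivative g s) (at s)"
    and g': "\<And>s. s > 0 \<Longrightarrow> (g has_real_derivative h s) (at s)"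
    and eq: "\<And>s. s > 0 \<Longrightarrow> h s = ?FC s (C s) (g s)"
    unfolding solves_on_iff_derivs[OF open_greaterThan] Ball_def greaterThan_iff by blast
  define G where "G = (\<lambda>x. C (x\<^sup>2 / 8) / 2 + x\<^sup>2 / 8 * g (x\<^sup>2 / 8))"
  define H where "H = (\<lambda>x. x / 4 * (3 / 2 * g (x\<^sup>2 / 8) + x\<^sup>2 / 8 * h (x\<^sup>2 / 8)))"
  have "Y x \<noteq> 0 \<and> (Y has_real_derivative G x) (at x) \<and> (G has_real_derivative H x) (at x)
      \<and> H x = ?FY x (Y x) (G x)" if "x > 0" for x
  proof (intro conjI)
    have pos: "x\<^sup>2 / 8 > 0"
      using that by simp
    show "Y x \<noteq> 0"
      unfolding Y[OF that] using that nz[OF pos] by simp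
    show "(Y has_real_derivative G x) (at x)" "(G has_real_derivative H x) (at x)"
      using derivs_forward[OF Y C' g' that] unfolding G_def H_def by auto
    show "H x = ?FY x (Y x) (G x)"
      using equation_iff[OF that nz[OF pos] refl Y[OF that], of "G x" "g (x\<^sup>2 / 8)" "H x" "h (x\<^sup>2 / 8)" \<alpha>]
        eq[OF pos] unfolding G_def H_def by blast
  qed
  then show "solves_on {0<..} ?FY Y"
    unfolding solves_on_iff_derivs[OF open_greaterThan] Ball_def greaterThan_iff by blast
next
  assume "solves_on {0<..} ?FY Y"
  then obtain G H where nz: "\<And>x. x > 0 \<Longrightarrow> Y x \<noteq> 0"
    and Y': "\<And>x. x > 0 \<Longrightarrow> (Y has_real_derivative G x) (at x)"
    and G': "\<And>x. x > 0 \<Longrightarrow> (G has_real_derivative H x) (at x)"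
    and eq: "\<And>x. x > 0 \<Longrightarrow> H x = ?FY x (Y x) (G x)"
    unfolding solves_on_iff_derivs[OF open_greaterThan] Ball_def greaterThan_iff by blast
  define g where "g = (\<lambda>s. (G (sqrt (8 * s)) - C s / 2) / s)"
  define h where "h = (\<lambda>s. (4 / sqrt (8 * s) * H (sqrt (8 * s)) - 3 / 2 * g s) / s)"
  have "C s \<noteq> 0 \<and> (C has_real_derivative g s) (at s) \<and> (g has_real_derivative h s) (at s)
      \<and> h s = ?FC s (C s) (g s)" if "s > 0" for s
  proof (intro conjI)
    define x where "x = sqrt (8 * s)"
    have x: "x > 0" and s: "s = x\<^sup>2 / 8"
      using that by (auto simp: x_def)
    have Yx: "Y x = x / 2 * C s"
      unfolding s by (rule Y[OF x])
    show nzC: "C s \<noteq> 0"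
      using nz[OF x] Yx by auto
    show "(C has_real_derivative g s) (at s)" "(g has_real_derivative h s) (at s)"
      using derivs_backward[OF Y Y' G' that] unfolding g_def h_def by auto
    have G_eq: "G x = C s / 2 + s * g s"
      using that by (simp add: g_def x_def)
    have H_eq: "H x = x / 4 * (3 / 2 * g s + s * h s)"
      using that x by (simp add: h_def flip: x_def)
    show "h s = ?FC s (C s) (g s)"
      using equation_iff[OF x nzC s Yx G_eq H_eq, of \<alpha>] eq[OF x] by blast
  qed
  then show "solves_on {0<..} ?FC C"
    unfolding solves_on_iff_derivs[OF open_greaterThan] Ball_def greaterThan_iff by blast
qed

lemma painleve_III_special:
  fixes \<alpha> x y p :: real
  shows "painleve_III 1 (2 * \<alpha>) 0 (- 1) x y p
    = p\<^sup>2 / y - p / x + y\<^sup>2 / x - 1 / y + 2 * \<alpha> / x"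
  by (simp add: painleve_III_def add_divide_distrib)

theorem mainTheorem3:
  fixes \<alpha> :: real and C Y :: "real \<Rightarrow> real"
  assumes "\<alpha> > 0"
    and "\<And>x. x > 0 \<Longrightarrow> Y x = x / 2 * C (x\<^sup>2 / 8)"
  shows "(solves_on {0<..}
            (\<lambda>s c p. p\<^sup>2 / c - p / s + c\<^sup>2 / s + \<alpha> / s\<^sup>2 - 1 / (s\<^sup>2 * c)) C
          \<longleftrightarrow> solves_on {0<..}
            (\<lambda>x y p. p\<^sup>2 / y - p / x + y\<^sup>2 / x - 1 / y + 2 * \<alpha> / x) Y)
       \<and> (solves_on {0<..}
            (\<lambda>s c p. p\<^sup>2 / c - p / s + c\<^sup>2 / s + \<alpha> / s\<^sup>2 - 1 / (s\<^sup>2 * c)) C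
          \<longleftrightarrow> solves_on {0<..} (painleve_III 1 (2 * \<alpha>) 0 (- 1)) Y)
       \<and> (\<forall>x y p. x > 0 \<longrightarrow> y \<noteq> 0 \<longrightarrow>
            p\<^sup>2 / y - p / x + y\<^sup>2 / x - 1 / y + 2 * \<alpha> / x
              = painleve_III 1 (2 * \<alpha>) 0 (- 1) x y p)"
  using solves_on_change_of_variables[OF assms(2), where \<alpha> = \<alpha>]
  unfolding painleve_III_special[abs_def] by simp

end
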